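(* Let $\mu$ be a probability measure on $\mathbb{T}$ with infinite support, $(\varphi_n)_{n\ge0}$ the orthonormal polynomials in $L^2_\mu$ and $(\psi_n)_{n\ge0}$ the related orthonormal second kind polynomials. Let $w\in\mathbb{T}$, $(c_1,c_2)\in\mathbb{R}^2\setminus\{(0,0)\}$, $p_n:=c_1\varphi_n+ic_2\psi_n$, and $$P_n(z):=p_n^*(w)\varphi_n(z)-p_n(w)\varphi_n^*(z),\qquad n\ge1.$$ Then the double limit points of the zeros of $(P_n)_{n\ge1}$ coincide with $\mathrm{supp}\,\mu$ except, at most, at the point $w$. Hence, if $w\in\mathrm{supp}\,\mu$, the set of double limit points of the zeros is exactly $\mathrm{supp}\,\mu$. When $c_2=0$, all the polynomials $P_n$ have a common zero at $w$, and both the set of double limit points and the set of strong limit points of the zeros coincide with $\mathrm{supp}\,\mu\cup\{w\}$.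
   Context: $\mathbb{T}=\{z\in\mathbb{C}:|z|=1\}$. The orthonormal polynomials in $L^2_\mu$ are $\varphi_n(z)=\kappa_n(z^n+\cdots+a_n)$, $\kappa_n>0$, where $(a_n)_{n\ge1}$ is the sequence of Schur parameters of $\mu$ ($|a_n|<1$). For a polynomial $p$ of degree $n$, $p^*(z):=z^n\overline p(z^{-1})$, $\overline p$ having the conjugated coefficients. With $\rho_n=\sqrt{1-|a_n|^2}$, $\varphi_0=1$ and $\rho_n\varphi_n(z)=z\varphi_{n-1}(z)+a_n\varphi_{n-1}^*(z)$. The second kind polynomials $\psi_n$ are the orthonormal polynomials associated with the Schur parameters $(-a_n)_{n\ge1}$, i.e. $\psi_0=1$, $\rho_n\psi_n(z)=z\psi_{n-1}(z)-a_n\psi_{n-1}^*(z)$. Each $P_n$ is, up to a nonzero constant, a para-orthogonal polynomial $z\varphi_{n-1}(z)+u_n\varphi_{n-1}^*(z)$ with $u_n\in\mathbb{T}$. Let $E_n$ be the set of zeros of $P_n$ and let $d$ denote the distance from a point to a set. The strong limit points are the $\lambda\in\mathbb{C}$ with $\lim_nd(\lambda,E_n)=0$. The double limit points are the $\lambda\in\mathbb{C}$ such that for some infinite set $\mathcal{I}\subset\mathbb{N}$, $\lim_{n\in\mathcal{I}}d(\lambda,E_n)=\lim_{n\in\mathcal{I}}d(\lambda,E_{n+1})=0$. *)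

theory Defs
  imports "HOL-Probability.Probability" "HOL-Computational_Algebra.Polynomial"
begin

definition circle_prob_measure :: "complex measure \<Rightarrow> bool" where
  "circle_prob_measure \<mu> \<longleftrightarrow>
     prob_space \<mu> \<and> sets \<mu> = sets borel \<and> (AE z in \<mu>. z \<in> sphere 0 1)"

definition supp :: "'a::topological_space measure \<Rightarrow> 'a set" where
  "supp \<mu> = {x. \<forall>U. open U \<longrightarrow> x \<in> U \<longrightarrow> emeasure \<mu> U > 0}"

definition orthonormal_polys :: "complex measure \<Rightarrow> (nat \<Rightarrow> complex poly) \<Rightarrow> bool" where
  "orthonormal_polys \<mu> \<phi> \<longleftrightarrow>
     (\<forall>n. degree (\<phi> n) = n) \<and>
     (\<forall>n. \<exists>\<kappa>>0. lead_coeff (\<phi> n) = complex_of_real \<kappa>) \<and>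
     (\<forall>m n. (\<integral>z. poly (\<phi> m) z * cnj (poly (\<phi> n) z) \<partial>\<mu>) = (if m = n then 1 else 0))"

text \<open>The reversed polynomial \<open>p\<^sup>*(z) = z\<^sup>n cnj (p (1 / cnj z))\<close> with \<open>n\<close> the degree of \<open>p\<close>;
  it is always applied below to polynomials whose degree is exactly their index.\<close>

definition star :: "complex poly \<Rightarrow> complex poly" where
  "star p = reflect_poly (map_poly cnj p)"

text \<open>Since \<open>\<phi>\<^sub>n(z) = \<kappa>\<^sub>n (z\<^sup>n + \<dots> + a\<^sub>n)\<close>, the parameter \<open>a\<^sub>n\<close> is the constant coefficient of the
  monic orthogonal polynomial. Only \<open>n \<ge> 1\<close> is meaningful.\<close>

definition schur_param :: "(nat \<Rightarrow> complex poly) \<Rightarrow> nat \<Rightarrow> complex" where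
  "schur_param \<phi> n = coeff (\<phi> n) 0 / lead_coeff (\<phi> n)"

primrec szego_polys :: "(nat \<Rightarrow> complex) \<Rightarrow> nat \<Rightarrow> complex poly" where
  "szego_polys a 0 = 1"
| "szego_polys a (Suc n) =
     smult (complex_of_real (1 / sqrt (1 - (cmod (a (Suc n)))\<^sup>2)))
       (pCons 0 (szego_polys a n) + smult (a (Suc n)) (star (szego_polys a n)))"

definition second_kind :: "(nat \<Rightarrow> complex poly) \<Rightarrow> nat \<Rightarrow> complex poly" where
  "second_kind \<phi> = szego_polys (\<lambda>n. - schur_param \<phi> n)"

definition comb_poly :: "(nat \<Rightarrow> complex poly) \<Rightarrow> real \<Rightarrow> real \<Rightarrow> nat \<Rightarrow> complex poly" where
  "comb_poly \<phi> c1 c2 n =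
     smult (complex_of_real c1) (\<phi> n) + smult (\<i> * complex_of_real c2) (second_kind \<phi> n)"

definition para_poly ::
    "(nat \<Rightarrow> complex poly) \<Rightarrow> real \<Rightarrow> real \<Rightarrow> complex \<Rightarrow> nat \<Rightarrow> complex poly" where
  "para_poly \<phi> c1 c2 w n =
     smult (poly (star (comb_poly \<phi> c1 c2 n)) w) (\<phi> n)
     - smult (poly (comb_poly \<phi> c1 c2 n) w) (star (\<phi> n))"

definition zero_set :: "complex poly \<Rightarrow> complex set" where
  "zero_set p = {z. poly p z = 0}"

text \<open>The sequences below are indexed by \<open>n \<ge> 1\<close>. Note that \<open>infdist x {} = 0\<close>; this convention
  plays no role here, as the zero sets of the para-orthogonal polynomials of index \<open>n \<ge> 1\<close>
  are nonempty.\<close>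

definition strong_limit_points :: "(nat \<Rightarrow> 'a::metric_space set) \<Rightarrow> 'a set" where
  "strong_limit_points E = {x. (\<lambda>n. infdist x (E n)) \<longlonglongrightarrow> 0}"

definition double_limit_points :: "(nat \<Rightarrow> 'a::metric_space set) \<Rightarrow> 'a set" where
  "double_limit_points E =
     {x. \<exists>I\<subseteq>{1..}. infinite I \<and>
          ((\<lambda>n. infdist x (E n)) \<longlongrightarrow> 0) (inf sequentially (principal I)) \<and>
          ((\<lambda>n. infdist x (E (Suc n))) \<longlongrightarrow> 0) (inf sequentially (principal I))}"

end

theory Submission
  imports Defs "HOL-Computational_Algebra.Fundamental_Theorem_Algebra"
begin

text \<open>
  Write \<open>K\<^sub>n(z, w) = \<Sum>k<n. \<phi>\<^sub>k(z) cnj (\<phi>\<^sub>k(w))\<close> for the Christoffel-Darboux kernel. On the circle the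
  modulus of \<open>\<phi>\<^sub>n\<^sup>*(z) \<phi>\<^sub>n(w) - \<phi>\<^sub>n(z) \<phi>\<^sub>n\<^sup>*(w)\<close> equals \<open>\<bar>z - w\<bar> \<bar>K\<^sub>n(z, w)\<bar>\<close>
  (\<open>kernel_circle\<close>), and both inclusions between the support and the limit points are read off from this
  identity.

  Limit points lie in the support. The zeros of \<open>P\<^sub>n\<close> are the points where the unimodular function
  \<open>b = \<phi>\<^sub>n / \<phi>\<^sub>n\<^sup>*\<close> takes a certain value \<open>t\<close>, and those of \<open>P\<^sub>n\<^sub>+\<^sub>1\<close> are the points where
  \<open>z b(z) = w t\<close> with the same \<open>t\<close> (\<open>P_Suc\<close>). Near a point different from \<open>w\<close>, close zeros of \<open>P\<^sub>n\<close> and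
  \<open>P\<^sub>n\<^sub>+\<^sub>1\<close> therefore require \<open>b\<close> to vary by a fixed amount over a short distance. But at distance
  \<open>\<epsilon>\<close> from the support \<open>\<epsilon>\<^sup>2 K\<^sub>n(\<zeta>, \<zeta>) \<le> 4 \<bar>\<phi>\<^sub>n(\<zeta>)\<bar>\<^sup>2\<close> (\<open>kernel_bound_off_support\<close>), which by
  Cauchy-Schwarz makes \<open>b\<close> Lipschitz there with a constant independent of \<open>n\<close>. Quantitatively,
  \<open>\<epsilon>\<^sup>2 \<bar>\<xi> - w\<bar> \<le> 4 \<bar>\<zeta> - \<xi>\<bar>\<close> for zeros \<open>\<zeta>\<close> of \<open>P\<^sub>n\<close> and \<open>\<xi>\<close> of \<open>P\<^sub>n\<^sub>+\<^sub>1\<close>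
  at distance at least \<open>\<epsilon>\<close> from the support (\<open>roots_in_gap\<close>).

  Points of the support are even strong limit points. The kernels at the \<open>n\<close> zeros of \<open>P\<^sub>n\<close> are
  orthogonal, so the squared norm of a polynomial of degree less than \<open>n\<close> is a convex combination of its
  squared moduli at the zeros (\<open>quadrature\<close>). A fixed polynomial that peaks sharply at a point of the support
  would violate this for all large \<open>n\<close> without zeros near that point (\<open>roots_near_supp\<close>).

  For \<open>c\<^sub>2 = 0\<close> each \<open>P\<^sub>n\<close> vanishes at \<open>w\<close>, so \<open>w\<close> is a strong limit point too. The rest of the development
  derives the Szego recursion from orthonormality, since the second kind polynomials are defined through the
  Schur parameters.
\<close>

section \<open>Reversed polynomials\<close>

lemma degree_map_poly_cnj: "degree (map_poly cnj p) = degree p"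
  by (rule degree_map_poly) auto

lemma coeff_star:
  "coeff (star p) i = (if i \<le> degree p then cnj (coeff p (degree p - i)) else 0)"
  by (auto simp: star_def coeff_reflect_poly degree_map_poly_cnj coeff_map_poly)

lemma unit_mult_cnj: "cmod z = 1 \<Longrightarrow> z * cnj z = 1"
  using complex_norm_square[of z] by simp

lemma poly_star_circle:
  assumes "cmod z = 1"
  shows "poly (star p) z = z ^ degree p * cnj (poly p z)"
proof -
  have "z \<noteq> 0" "z * cnj z = 1"
    using assms by (auto simp: unit_mult_cnj)
  then have "cnj (inverse z) = z"
    by (metis complex_cnj_cnj inverse_unique)
  with \<open>z \<noteq> 0\<close> show ?thesis
    by (simp add: star_def poly_reflect_poly_nz degree_map_poly_cnj)
qed

section \<open>The Szego recursion\<close>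

text \<open>The algebra of the recursion depends only on parameters in the open unit disk. It is
  developed without a measure because it is needed twice: for the Schur parameters of \<open>\<mu>\<close> and, for
  the second kind polynomials, for their negatives.\<close>

locale schur_sequence =
  fixes a :: "nat \<Rightarrow> complex"
  assumes schur_bound: "cmod (a (Suc n)) < 1"
begin

abbreviation S :: "nat \<Rightarrow> complex poly" where
  "S \<equiv> szego_polys a"

definition rho :: "nat \<Rightarrow> real" where
  "rho n = sqrt (1 - (cmod (a (Suc n)))\<^sup>2)"

lemma rho_pos: "rho n > 0"
  using schur_bound[of n] by (simp add: rho_def power_less_one_iff)

lemma rho_mult_self: "complex_of_real (rho n) * of_real (rho n) = 1 - a (Suc n) * cnj (a (Suc n))"
proof -
  have "rho n * rho n = 1 - (cmod (a (Suc n)))\<^sup>2"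
    using schur_bound[of n] by (simp add: rho_def power_le_one_iff less_imp_le)
  then show ?thesis
    by (metis complex_norm_square of_real_1 of_real_diff of_real_mult)
qed

lemma S_Suc:
  "S (Suc n) = smult (1 / of_real (rho n)) (pCons 0 (S n) + smult (a (Suc n)) (star (S n)))"
  by (simp add: rho_def)

text \<open>Degree and leading coefficient are determined by the moduli of the parameters alone. Hence
  \<open>\<phi>\<^sub>n\<close> and \<open>\<psi>\<^sub>n\<close> have the same positive leading coefficient and a combination
  \<open>c\<^sub>1 \<phi>\<^sub>n + \<i> c\<^sub>2 \<psi>\<^sub>n\<close> with \<open>(c\<^sub>1, c\<^sub>2) \<noteq> (0, 0)\<close> keeps the full degree \<open>n\<close>.\<close>

lemma degree_le_lead:
  "degree (S n) \<le> n \<and> coeff (S n) n = of_real (\<Prod>k<n. 1 / rho k)"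
proof (induction n)
  case (Suc n)
  then have "degree (S (Suc n)) \<le> Suc n"
    unfolding S_Suc by (intro degree_le) (auto simp: coeff_star coeff_pCons coeff_eq_0 split: nat.split)
  moreover have "coeff (star (S n)) (Suc n) = 0"
    using Suc by (simp add: coeff_star)
  ultimately show ?case
    using Suc unfolding S_Suc by simp
qed simp

lemma lead_pos: "(\<Prod>k<n. 1 / rho k) > 0"
  by (intro prod_pos) (simp add: rho_pos)

lemma lead_nonzero: "coeff (S n) n \<noteq> 0"
  using degree_le_lead[of n] lead_pos[of n] by (metis of_real_eq_0_iff less_irrefl)

lemma degree_S: "degree (S n) = n"
  using degree_le_lead[of n] lead_nonzero[of n] by (simp add: le_antisym le_degree)

lemma coeff_star_S: "coeff (star (S n)) i = (if i \<le> n then cnj (coeff (S n) (n - i)) else 0)"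
  by (simp add: coeff_star degree_S)

lemma star_S_Suc:
  "star (S (Suc n)) =
     smult (1 / of_real (rho n)) (star (S n) + smult (cnj (a (Suc n))) (pCons 0 (S n)))"
proof (rule poly_eqI)
  fix i
  have high: "coeff (S n) j = 0" if "j > n" for j
    using that by (simp add: coeff_eq_0 degree_S)
  show "coeff (star (S (Suc n))) i = coeff (smult (1 / of_real (rho n))
          (star (S n) + smult (cnj (a (Suc n))) (pCons 0 (S n)))) i"
  proof (cases "i = Suc n")
    case False
    then show ?thesis
      unfolding coeff_star_S
      by (auto simp: S_Suc coeff_star_S coeff_pCons high Suc_diff_le
               simp del: szego_polys.simps split: nat.split)
  next
    case True
    then show ?thesis
      unfolding coeff_star_S by (simp add: S_Suc coeff_star_S del: szego_polys.simps)
  qed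
qed

lemma poly_S_Suc:
  "of_real (rho n) * poly (S (Suc n)) z = z * poly (S n) z + a (Suc n) * poly (star (S n)) z"
  using rho_pos[of n] by (simp add: S_Suc del: szego_polys.simps)

lemma poly_star_S_Suc:
  "of_real (rho n) * poly (star (S (Suc n))) z
     = poly (star (S n)) z + cnj (a (Suc n)) * (z * poly (S n) z)"
  using rho_pos[of n] by (simp add: star_S_Suc del: szego_polys.simps)

lemma poly_star_S_circle: "cmod z = 1 \<Longrightarrow> poly (star (S n)) z = z ^ n * cnj (poly (S n) z)"
  by (simp add: poly_star_circle degree_S)

definition cd_kernel :: "nat \<Rightarrow> complex \<Rightarrow> complex poly" where
  "cd_kernel n w = (\<Sum>k<n. smult (cnj (poly (S k) w)) (S k))"

lemma poly_cd_kernel: "poly (cd_kernel n w) z = (\<Sum>k<n. cnj (poly (S k) w) * poly (S k) z)"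
  by (simp add: cd_kernel_def poly_sum)

text \<open>Up to the factor \<open>z\<close> in the first component, the transfer matrix taking
  \<open>(S\<^sub>n, S\<^sub>n\<^sup>*)\<close> to \<open>(S\<^sub>n\<^sub>+\<^sub>1, S\<^sub>n\<^sub>+\<^sub>1\<^sup>*)\<close> preserves the Hermitian form
  \<open>\<bar>y\<bar>\<^sup>2 - \<bar>x\<bar>\<^sup>2\<close>, so each step of the recursion changes the left-hand side only by
  the factor \<open>z cnj w\<close> in the first component, which contributes exactly one term of the kernel.\<close>

lemma christoffel_darboux:
  "poly (star (S n)) z * cnj (poly (star (S n)) w) - poly (S n) z * cnj (poly (S n) w)
     = (1 - z * cnj w) * poly (cd_kernel n w) z"
proof (induction n)
  case 0
  then show ?case by (simp add: cd_kernel_def star_def)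
next
  case (Suc n)
  let ?r = "complex_of_real (rho n)" and ?a = "a (Suc n)"
  let ?f = "poly (S n) z" and ?fs = "poly (star (S n)) z"
  let ?g = "cnj (poly (S n) w)" and ?gs = "cnj (poly (star (S n)) w)"
  let ?F = "poly (S (Suc n)) z" and ?Fs = "poly (star (S (Suc n))) z"
  let ?G = "cnj (poly (S (Suc n)) w)" and ?Gs = "cnj (poly (star (S (Suc n))) w)"
  have F: "?r * ?F = z * ?f + ?a * ?fs" "?r * ?Fs = ?fs + cnj ?a * (z * ?f)"
    by (simp_all only: poly_S_Suc poly_star_S_Suc)
  have G: "?r * ?G = cnj w * ?g + cnj ?a * ?gs" "?r * ?Gs = ?gs + ?a * (cnj w * ?g)"
    using arg_cong[OF poly_S_Suc, of cnj n w] arg_cong[OF poly_star_S_Suc, of cnj n w]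
    by (simp_all del: szego_polys.simps)
  have r: "?r * ?r = 1 - ?a * cnj ?a" by (rule rho_mult_self)
  have "(?r * ?r) * (?Fs * ?Gs - ?F * ?G) = (?r * ?Fs) * (?r * ?Gs) - (?r * ?F) * (?r * ?G)"
    by (simp add: algebra_simps del: szego_polys.simps)
  also have "\<dots> = (1 - ?a * cnj ?a) * (?fs * ?gs - z * cnj w * (?f * ?g))"
    unfolding F G by (simp add: algebra_simps)
  finally have "?Fs * ?Gs - ?F * ?G = ?fs * ?gs - z * cnj w * (?f * ?g)"
    using r rho_pos[of n]
    by (metis less_irrefl mult_cancel_left mult_eq_0_iff of_real_eq_0_iff)
  also have "\<dots> = (?fs * ?gs - ?f * ?g) + (1 - z * cnj w) * (?f * ?g)"
    by (simp add: algebra_simps)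
  also have "\<dots> = (1 - z * cnj w) * poly (cd_kernel (Suc n) w) z"
    unfolding Suc by (simp add: poly_cd_kernel algebra_simps)
  finally show ?case .
qed

lemma kernel_diag:
  "poly (cd_kernel n z) z = of_real (\<Sum>k<n. (cmod (poly (S k) z))\<^sup>2)"
  by (simp add: poly_cd_kernel complex_norm_square mult.commute del: of_real_power)

lemma kernel_diag_pos: "n \<ge> 1 \<Longrightarrow> (\<Sum>k<n. (cmod (poly (S k) z))\<^sup>2) > 0"
  by (rule sum_pos2[of _ 0]) auto

lemma kernel_diag_nonzero: "n \<ge> 1 \<Longrightarrow> poly (cd_kernel n z) z \<noteq> 0"
  using kernel_diag_pos[of n z] unfolding kernel_diag by (metis less_irrefl of_real_eq_0_iff)

lemma kernel_cauchy_schwarz: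
  "(cmod (poly (cd_kernel n w) z))\<^sup>2
     \<le> (\<Sum>k<n. (cmod (poly (S k) z))\<^sup>2) * (\<Sum>k<n. (cmod (poly (S k) w))\<^sup>2)"
proof -
  have "cmod (poly (cd_kernel n w) z) \<le> (\<Sum>k<n. cmod (poly (S k) z) * cmod (poly (S k) w))"
    unfolding poly_cd_kernel by (rule sum_norm_le) (simp add: norm_mult mult.commute)
  then have "(cmod (poly (cd_kernel n w) z))\<^sup>2 \<le> (\<Sum>k<n. cmod (poly (S k) z) * cmod (poly (S k) w))\<^sup>2"
    by (rule power_mono) simp
  also have "\<dots> \<le> (\<Sum>k<n. (cmod (poly (S k) z))\<^sup>2) * (\<Sum>k<n. (cmod (poly (S k) w))\<^sup>2)"
    by (rule Cauchy_Schwarz_ineq_sum)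
  finally show ?thesis .
qed

text \<open>On the circle \<open>S\<^sub>n\<^sup>*\<close> is \<open>z\<^sup>n\<close> times the conjugate of \<open>S\<^sub>n\<close>, which turns the Hermitian form into the
  determinant of the two vectors \<open>(S\<^sub>n, S\<^sub>n\<^sup>*)\<close>; this determinant vanishes precisely when
  \<open>S\<^sub>n / S\<^sub>n\<^sup>*\<close> takes the same value at both points.\<close>

lemma kernel_circle:
  assumes "cmod z = 1" "cmod w = 1"
  shows "cmod (poly (star (S n)) z * poly (S n) w - poly (S n) z * poly (star (S n)) w)
           = cmod (z - w) * cmod (poly (cd_kernel n w) z)"
proof -
  have w: "w * cnj w = 1" "cnj w * w = 1"
    using assms by (auto simp: unit_mult_cnj mult.commute)
  have "w ^ n * cnj w ^ n = 1"
    by (simp add: w flip: power_mult_distrib)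
  then have "poly (star (S n)) z * poly (S n) w - poly (S n) z * poly (star (S n)) w
      = w ^ n * (poly (star (S n)) z * cnj (poly (star (S n)) w) - poly (S n) z * cnj (poly (S n) w))"
    using assms by (simp add: poly_star_S_circle[of w] algebra_simps)
  also have "\<dots> = w ^ n * ((1 - z * cnj w) * poly (cd_kernel n w) z)"
    by (simp only: christoffel_darboux)
  also have "1 - z * cnj w = (w - z) * cnj w"
    using w by (simp add: algebra_simps)
  finally show ?thesis
    using assms by (simp add: norm_mult norm_power norm_minus_commute)
qed

end

section \<open>Para-orthogonal polynomials\<close>

text \<open>The sequence \<open>q\<close> is any solution at the point \<open>w\<close> of the recursion in the form that it takes on
  the circle. The recursion is only real linear in \<open>q\<close>, and its solutions are exactly the real
  combinations of \<open>\<phi>\<^sub>n(w)\<close> and \<open>\<i> \<psi>\<^sub>n(w)\<close>; this is why \<open>c\<^sub>1\<close> and \<open>c\<^sub>2\<close> have to be real.\<close>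

locale para_orthogonal = schur_sequence +
  fixes w :: complex and q :: "nat \<Rightarrow> complex"
  assumes w_circle: "cmod w = 1"
    and q_0: "q 0 \<noteq> 0"
    and q_Suc: "of_real (rho n) * q (Suc n) = w * q n + a (Suc n) * (w ^ n * cnj (q n))"
begin

definition P :: "nat \<Rightarrow> complex poly" where
  "P n = smult (w ^ n * cnj (q n)) (S n) - smult (q n) (star (S n))"

lemma q_nonzero: "q n \<noteq> 0"
proof (induction n)
  case (Suc n)
  show ?case
  proof
    assume "q (Suc n) = 0"
    then have "w * q n = - (a (Suc n) * (w ^ n * cnj (q n)))"
      using q_Suc[of n] by (simp add: eq_neg_iff_add_eq_0)
    then have "cmod (w * q n) = cmod (a (Suc n) * (w ^ n * cnj (q n)))"
      by (metis norm_minus_cancel)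
    then have "cmod (q n) = cmod (a (Suc n)) * cmod (q n)"
      using w_circle by (simp add: norm_mult norm_power)
    with Suc schur_bound[of n] show False by simp
  qed
qed (rule q_0)

lemma w_nonzero: "w \<noteq> 0" using w_circle by auto

text \<open>The vectors \<open>(S\<^sub>n(z), S\<^sub>n\<^sup>*(z))\<close> and \<open>(q\<^sub>n, w\<^sup>n cnj q\<^sub>n)\<close> are transported by transfer
  matrices that differ only in the scalar \<open>z\<close> or \<open>w\<close> applied to the first component, and the
  remaining matrix has determinant one. So the determinant \<open>P\<^sub>n\<^sub>+\<^sub>1(z)\<close> of the transported
  vectors can be written with the data of index \<open>n\<close>. Thus the zeros of both \<open>P\<^sub>n\<close> and \<open>P\<^sub>n\<^sub>+\<^sub>1\<close>
  are level sets of the same function \<open>S\<^sub>n / S\<^sub>n\<^sup>*\<close>, the second one after multiplication by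
  \<open>z / w\<close>.\<close>

lemma P_Suc:
  "P (Suc n) = smult (w ^ n * cnj (q n)) (pCons 0 (S n)) - smult (w * q n) (star (S n))"
proof -
  have "poly (P (Suc n)) z = w ^ n * cnj (q n) * (z * poly (S n) z) - w * q n * poly (star (S n)) z"
    (is "_ = ?R") for z
  proof -
    let ?r = "complex_of_real (rho n)" and ?a = "a (Suc n)"
    let ?f = "poly (S n) z" and ?fs = "poly (star (S n)) z"
    let ?F = "poly (S (Suc n)) z" and ?Fs = "poly (star (S (Suc n))) z"
    have F: "?r * ?F = z * ?f + ?a * ?fs" "?r * ?Fs = ?fs + cnj ?a * (z * ?f)"
      by (simp_all only: poly_S_Suc poly_star_S_Suc)
    have r: "?r * ?r = 1 - ?a * cnj ?a" by (rule rho_mult_self)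
    have w: "w * cnj w = 1"
      using w_circle by (simp add: unit_mult_cnj)
    have wn: "w ^ n * cnj w ^ n = 1"
      by (simp add: w flip: power_mult_distrib)
    have "w ^ Suc n * (?r * cnj (q (Suc n))) = w ^ Suc n * cnj (?r * q (Suc n))"
      by simp
    also have "\<dots> = (w * cnj w) * (w ^ n * cnj (q n)) + cnj ?a * w * ((w ^ n * cnj w ^ n) * q n)"
      unfolding q_Suc by (simp add: algebra_simps)
    finally have Q: "w ^ Suc n * (?r * cnj (q (Suc n))) = w ^ n * cnj (q n) + cnj ?a * w * q n"
      using w wn by simp
    have "(?r * ?r) * poly (P (Suc n)) z
        = (w ^ Suc n * (?r * cnj (q (Suc n)))) * (?r * ?F) - (?r * q (Suc n)) * (?r * ?Fs)"
      by (simp add: P_def algebra_simps del: szego_polys.simps)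
    also have "\<dots> = (?r * ?r) * ?R"
      unfolding F Q q_Suc r by (simp add: algebra_simps)
    finally show ?thesis
      using rho_pos[of n] by simp
  qed
  then show ?thesis
    by (intro poly_ext) (simp add: mult_ac)
qed

lemma degree_P: "degree (P n) = n" if "n \<ge> 1"
proof -
  obtain m where m: "n = Suc m" using \<open>n \<ge> 1\<close> by (cases n) auto
  have "degree (P n) \<le> n"
    unfolding m P_Suc
    by (intro degree_le) (auto simp: coeff_star degree_S coeff_pCons coeff_eq_0 split: nat.split)
  moreover have "coeff (P n) n \<noteq> 0"
    using lead_nonzero[of m]
    unfolding m P_Suc by (simp add: coeff_star_S q_nonzero w_nonzero)
  ultimately show ?thesis
    by (meson le_antisym le_degree)
qed

lemma root_iff:
  "poly (P n) z = 0 \<longleftrightarrow> w ^ n * cnj (q n) * poly (S n) z = q n * poly (star (S n)) z"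
  by (simp add: P_def)

text \<open>At a zero \<open>\<bar>S\<^sub>n\<bar> = \<bar>S\<^sub>n\<^sup>*\<bar>\<close>, whereas by the Christoffel-Darboux formula on the diagonal
  \<open>\<bar>S\<^sub>n\<^sup>*\<bar>\<^sup>2 - \<bar>S\<^sub>n\<bar>\<^sup>2\<close> is \<open>1 - \<bar>z\<bar>\<^sup>2\<close> times a positive number.\<close>

lemma root_circle:
  assumes "n \<ge> 1" "poly (P n) z = 0"
  shows "cmod z = 1"
proof -
  have "cmod (w ^ n * cnj (q n) * poly (S n) z) = cmod (q n * poly (star (S n)) z)"
    using assms(2) root_iff by metis
  then have "cmod (poly (S n) z) = cmod (poly (star (S n)) z)"
    using w_circle q_nonzero by (simp add: norm_mult norm_power)
  then have "poly (star (S n)) z * cnj (poly (star (S n)) z) - poly (S n) z * cnj (poly (S n) z) = 0"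
    by (simp flip: complex_norm_square)
  then have "z * cnj z = 1"
    using kernel_diag_nonzero[OF assms(1), of z] unfolding christoffel_darboux by simp
  then have "(cmod z)\<^sup>2 = 1"
    by (metis complex_norm_square of_real_eq_1_iff)
  then show ?thesis
    by (simp add: power2_eq_1_iff) (use norm_ge_zero[of z] in linarith)
qed

text \<open>A zero \<open>\<zeta>\<close> fixes the value of \<open>S\<^sub>n / S\<^sub>n\<^sup>*\<close>, and on the circle this value determines \<open>P\<^sub>n\<close> up to a
  factor; the Christoffel-Darboux formula at \<open>\<zeta>\<close> supplies a polynomial with the same value. This makes
  the zeros simple and the kernels at different zeros orthogonal.\<close>

lemma P_eq_kernel:
  assumes "n \<ge> 1" "poly (P n) \<zeta> = 0"
  obtains c where "smult c (P n) = [:-\<zeta>, 1:] * cd_kernel n \<zeta>"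
proof -
  have \<zeta>: "cmod \<zeta> = 1" using root_circle assms by blast
  then have z1: "\<zeta> * cnj \<zeta> = 1" by (simp add: unit_mult_cnj)
  define s where "s = poly (star (S n)) \<zeta>"
  have root: "w ^ n * cnj (q n) * poly (S n) \<zeta> = q n * s"
    using assms(2) root_iff s_def by metis
  have wn: "w ^ n * cnj w ^ n = 1"
    using w_circle by (simp add: unit_mult_cnj flip: power_mult_distrib)
  have "q n * cnj (poly (S n) \<zeta>) = w ^ n * (cnj (w ^ n * cnj (q n) * poly (S n) \<zeta>))"
    using wn by (simp add: mult_ac)
  also have "\<dots> = w ^ n * cnj (q n) * cnj s"
    unfolding root by simp
  finally have conj: "q n * cnj (poly (S n) \<zeta>) = w ^ n * cnj (q n) * cnj s" .
  have "poly (smult (\<zeta> * cnj s) (P n)) z = poly (smult (q n) ([:-\<zeta>, 1:] * cd_kernel n \<zeta>)) z" for z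
  proof -
    have "poly (smult (q n) ([:-\<zeta>, 1:] * cd_kernel n \<zeta>)) z
            = - \<zeta> * q n * ((1 - z * cnj \<zeta>) * poly (cd_kernel n \<zeta>) z)"
      using z1 by (simp add: algebra_simps)
    also have "\<dots> = - \<zeta> * (q n * cnj s * poly (star (S n)) z - poly (S n) z * (q n * cnj (poly (S n) \<zeta>)))"
      unfolding christoffel_darboux[symmetric] s_def by (simp add: algebra_simps)
    also have "\<dots> = poly (smult (\<zeta> * cnj s) (P n)) z"
      unfolding conj by (simp add: P_def algebra_simps)
    finally show ?thesis by simp
  qed
  then have eq: "smult (\<zeta> * cnj s) (P n) = smult (q n) ([:-\<zeta>, 1:] * cd_kernel n \<zeta>)"
    by (intro poly_ext)
  have "smult (1 / q n) (smult (\<zeta> * cnj s) (P n)) = [:-\<zeta>, 1:] * cd_kernel n \<zeta>"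
    unfolding eq using q_nonzero[of n] by simp
  then have "smult (\<zeta> * cnj s / q n) (P n) = [:-\<zeta>, 1:] * cd_kernel n \<zeta>"
    by simp
  then show ?thesis by (rule that)
qed

lemma kernel_root_orthogonal:
  assumes "n \<ge> 1" "poly (P n) \<zeta> = 0" "poly (P n) \<xi> = 0" "\<zeta> \<noteq> \<xi>"
  shows "poly (cd_kernel n \<zeta>) \<xi> = 0"
proof -
  obtain c where "smult c (P n) = [:-\<zeta>, 1:] * cd_kernel n \<zeta>"
    using P_eq_kernel assms by blast
  then have "c * poly (P n) \<xi> = (\<xi> - \<zeta>) * poly (cd_kernel n \<zeta>) \<xi>"
    by (metis add.commute diff_conv_add_uminus mult.right_neutral poly_0 poly_mult poly_pCons poly_smult mult_zero_right add_0_right)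
  with assms show ?thesis by simp
qed

lemma rsquarefree_P:
  assumes "n \<ge> 1" shows "rsquarefree (P n)"
  unfolding rsquarefree_roots
proof (intro allI notI)
  fix \<zeta> assume *: "poly (P n) \<zeta> = 0 \<and> poly (pderiv (P n)) \<zeta> = 0"
  then obtain c where c: "smult c (P n) = [:-\<zeta>, 1:] * cd_kernel n \<zeta>"
    using P_eq_kernel assms by blast
  have "poly (cd_kernel n \<zeta>) \<zeta> = poly (pderiv ([:-\<zeta>, 1:] * cd_kernel n \<zeta>)) \<zeta>"
    unfolding pderiv_mult by (simp add: pderiv_pCons)
  also have "\<dots> = 0"
    using * unfolding c[symmetric] by (simp add: pderiv_smult)
  finally have "poly (cd_kernel n \<zeta>) \<zeta> = 0" .
  then show False using kernel_diag_nonzero assms by blast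
qed

lemma card_roots: "n \<ge> 1 \<Longrightarrow> card {z. poly (P n) z = 0} = n"
proof -
  assume n: "n \<ge> 1"
  have nz: "P n \<noteq> 0" using degree_P[OF n] n by auto
  have "degree (smult (lead_coeff (P n)) (\<Prod>z|poly (P n) z = 0. [:-z, 1:])) = n"
    using complex_poly_decompose_rsquarefree[OF rsquarefree_P[OF n]] degree_P[OF n] by simp
  then show ?thesis
    using nz by (simp add: degree_prod_eq_sum_degree)
qed

text \<open>The zeros of \<open>P\<^sub>n\<close> and \<open>P\<^sub>n\<^sub>+\<^sub>1\<close> prescribe values of \<open>S\<^sub>n / S\<^sub>n\<^sup>*\<close> that differ by the factor
  \<open>\<xi> / w\<close>, so a short distance between \<open>\<zeta>\<close> and \<open>\<xi>\<close> away from \<open>w\<close> forces the kernel to be large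
  in comparison with \<open>S\<^sub>n\<close>.\<close>

lemma consecutive_roots:
  assumes "n \<ge> 1" "poly (P n) \<zeta> = 0" "poly (P (Suc n)) \<xi> = 0"
  shows "cmod (\<xi> - w) * (cmod (poly (S n) \<zeta>) * cmod (poly (S n) \<xi>))
           = cmod (\<zeta> - \<xi>) * cmod (poly (cd_kernel n \<xi>) \<zeta>)"
proof -
  have circle: "cmod \<zeta> = 1" "cmod \<xi> = 1"
    using root_circle assms by (auto intro: root_circle[of "Suc n"])
  define f g fs gs where "f = poly (S n) \<zeta>" and "g = poly (S n) \<xi>"
    and "fs = poly (star (S n)) \<zeta>" and "gs = poly (star (S n)) \<xi>"
  have 1: "w ^ n * cnj (q n) * f = q n * fs"
    using assms(2) unfolding root_iff f_def fs_def .
  have 2: "w ^ n * cnj (q n) * (\<xi> * g) = w * q n * gs"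
    using assms(3) unfolding P_Suc g_def gs_def by (simp add: algebra_simps)
  have "(w ^ n * cnj (q n) * f) * (w * q n * gs) = (q n * fs) * (w ^ n * cnj (q n) * (\<xi> * g))"
    unfolding 1 2 ..
  then have "f * gs * w = \<xi> * (fs * g)"
    using q_nonzero[of n] w_nonzero by (simp add: mult_ac)
  then have "w * (fs * g - f * gs) = (w - \<xi>) * (fs * g)"
    by (simp add: algebra_simps)
  then have "cmod (w * (fs * g - f * gs)) = cmod ((w - \<xi>) * (fs * g))" by simp
  moreover have "cmod fs = cmod f"
    unfolding fs_def f_def using circle by (simp add: poly_star_S_circle norm_mult norm_power)
  ultimately have "cmod (fs * g - f * gs) = cmod (\<xi> - w) * (cmod f * cmod g)"
    using w_circle by (simp add: norm_mult norm_minus_commute)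
  then show ?thesis
    using kernel_circle[OF circle, of n] unfolding f_def g_def fs_def gs_def by simp
qed

end

section \<open>Orthonormal polynomials satisfy the Szego recursion\<close>

locale opuc =
  fixes \<mu> :: "complex measure" and \<phi> :: "nat \<Rightarrow> complex poly"
  assumes circle: "circle_prob_measure \<mu>" and ortho: "orthonormal_polys \<mu> \<phi>"
begin

sublocale prob_space \<mu>
  using circle by (simp add: circle_prob_measure_def)

lemma AE_circle: "AE z in \<mu>. cmod z = 1"
  using circle by (simp add: circle_prob_measure_def)

lemma sets_mu: "sets \<mu> = sets borel"
  using circle by (simp add: circle_prob_measure_def)

lemma measurable_continuous:
  fixes f :: "complex \<Rightarrow> 'b::{banach, second_countable_topology}"
  assumes "continuous_on UNIV f"
  shows "f \<in> borel_measurable \<mu>"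
  using borel_measurable_continuous_onI[OF assms] measurable_cong_sets[OF sets_mu refl] by blast

lemma integrable_continuous:
  fixes f :: "complex \<Rightarrow> 'b::{banach, second_countable_topology}"
  assumes "continuous_on UNIV f"
  shows "integrable \<mu> f"
proof -
  have "compact (f ` sphere 0 1)"
    by (intro compact_continuous_image continuous_on_subset[OF assms]) auto
  then obtain B where B: "\<And>z. z \<in> sphere 0 1 \<Longrightarrow> norm (f z) \<le> B"
    by (meson bounded_iff compact_imp_bounded imageI)
  have "AE z in \<mu>. norm (f z) \<le> B"
    using AE_circle by eventually_elim (auto intro: B)
  then show ?thesis
    using integrable_const_bound measurable_continuous[OF assms] by blast
qed

definition ip :: "complex poly \<Rightarrow> complex poly \<Rightarrow> complex" where
  "ip p q = (\<integral>z. poly p z * cnj (poly q z) \<partial>\<mu>)"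

lemma integrable_ip: "integrable \<mu> (\<lambda>z. poly p z * cnj (poly q z))"
  by (intro integrable_continuous continuous_intros)

lemma ip_add_left: "ip (p + q) r = ip p r + ip q r"
  unfolding ip_def
  by (subst Bochner_Integration.integral_add[symmetric])
     (auto intro: integrable_ip simp: algebra_simps)

lemma ip_add_right: "ip p (q + r) = ip p q + ip p r"
  unfolding ip_def
  by (subst Bochner_Integration.integral_add[symmetric])
     (auto intro: integrable_ip simp: algebra_simps)

lemma ip_smult_left: "ip (smult c p) q = c * ip p q"
  by (simp add: ip_def mult.assoc)

lemma ip_smult_right: "ip p (smult c q) = cnj c * ip p q"
  by (simp add: ip_def mult.left_commute)

lemma ip_0_left [simp]: "ip 0 q = 0" and ip_0_right [simp]: "ip p 0 = 0"
  by (simp_all add: ip_def)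

lemma ip_diff_left: "ip (p - q) r = ip p r - ip q r"
  using ip_add_left[of p "smult (-1) q" r] ip_smult_left[of "-1" q r] by simp

lemma ip_diff_right: "ip p (q - r) = ip p q - ip p r"
  using ip_add_right[of p q "smult (-1) r"] ip_smult_right[of p "-1" r] by simp

lemma ip_sum_left: "ip (\<Sum>k\<in>A. f k) q = (\<Sum>k\<in>A. ip (f k) q)"
  by (induction A rule: infinite_finite_induct) (auto simp: ip_add_left)

lemma ip_sum_right: "ip p (\<Sum>k\<in>A. f k) = (\<Sum>k\<in>A. ip p (f k))"
  by (induction A rule: infinite_finite_induct) (auto simp: ip_add_right)

lemma ip_commute: "ip q p = cnj (ip p q)"
  by (simp add: ip_def mult.commute flip: Bochner_Integration.integral_cnj)

lemma ip_self: "ip p p = of_real (\<integral>z. (cmod (poly p z))\<^sup>2 \<partial>\<mu>)"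
  unfolding ip_def complex_norm_square[symmetric] by (rule integral_complex_of_real)

lemma ip_cong_circle:
  assumes "\<And>z. cmod z = 1 \<Longrightarrow> poly p z * cnj (poly q z) = poly r z * cnj (poly s z)"
  shows "ip p q = ip r s"
  unfolding ip_def
proof (rule integral_cong_AE)
  show "AE z in \<mu>. poly p z * cnj (poly q z) = poly r z * cnj (poly s z)"
    using AE_circle by eventually_elim (rule assms)
qed (auto intro!: borel_measurable_integrable integrable_ip)

lemma ip_shift: "ip (pCons 0 p) (pCons 0 q) = ip p q"
proof (rule ip_cong_circle)
  fix z :: complex assume "cmod z = 1"
  then have "z * cnj z = 1" by (rule unit_mult_cnj)
  have "poly (pCons 0 p) z * cnj (poly (pCons 0 q) z) = (z * cnj z) * (poly p z * cnj (poly q z))"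
    by simp
  with \<open>z * cnj z = 1\<close>
  show "poly (pCons 0 p) z * cnj (poly (pCons 0 q) z) = poly p z * cnj (poly q z)" by simp
qed

lemma degree_phi: "degree (\<phi> n) = n"
  using ortho by (simp add: orthonormal_polys_def)

definition kappa :: "nat \<Rightarrow> real" where
  "kappa n = Re (lead_coeff (\<phi> n))"

lemma kappa_pos: "kappa n > 0" and coeff_phi: "coeff (\<phi> n) n = of_real (kappa n)"
proof -
  obtain k where "k > 0" "lead_coeff (\<phi> n) = complex_of_real k"
    using ortho unfolding orthonormal_polys_def by blast
  then show "kappa n > 0" "coeff (\<phi> n) n = of_real (kappa n)"
    by (simp_all add: kappa_def degree_phi)
qed

lemma ip_phi: "ip (\<phi> m) (\<phi> n) = (if m = n then 1 else 0)"
  using ortho unfolding orthonormal_polys_def ip_def by blast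

lemma ip_phi_sums:
  "ip (\<Sum>k<n. smult (c k) (\<phi> k)) (\<Sum>k<n. smult (d k) (\<phi> k)) = (\<Sum>k<n. c k * cnj (d k))"
proof -
  have "ip (\<Sum>k<n. smult (c k) (\<phi> k)) (\<Sum>k<n. smult (d k) (\<phi> k))
          = (\<Sum>i<n. \<Sum>j<n. if i = j then c i * cnj (d j) else 0)"
    unfolding ip_sum_left ip_sum_right
    by (intro sum.cong) (auto simp: ip_smult_left ip_smult_right ip_phi)
  then show ?thesis by simp
qed

text \<open>The condition on the coefficients expresses that the degree is less than \<open>n\<close> and remains
  meaningful for \<open>n = 0\<close>, where it leaves only the zero polynomial.\<close>

lemma phi_expansion:
  assumes "\<And>i. i \<ge> n \<Longrightarrow> coeff p i = 0"
  shows "\<exists>c. p = (\<Sum>k<n. smult (c k) (\<phi> k))"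
  using assms
proof (induction n arbitrary: p)
  case 0
  then show ?case by (simp add: poly_eqI)
next
  case (Suc n)
  define d where "d = coeff p n / of_real (kappa n)"
  have "coeff (p - smult d (\<phi> n)) i = 0" if "i \<ge> n" for i
  proof (cases "i = n")
    case True
    then show ?thesis using kappa_pos[of n] by (simp add: d_def coeff_phi)
  next
    case False
    then show ?thesis using that Suc.prems by (simp add: coeff_eq_0 degree_phi)
  qed
  from Suc.IH[OF this] obtain c where c: "p - smult d (\<phi> n) = (\<Sum>k<n. smult (c k) (\<phi> k))"
    by blast
  have "p = (\<Sum>k<Suc n. smult ((c(n := d)) k) (\<phi> k))"
    using c by (simp add: diff_eq_eq)
  then show ?case by blast
qed

lemma ip_low:
  assumes "\<And>i. i \<ge> n \<Longrightarrow> coeff p i = 0"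
  shows "ip p (\<phi> n) = 0" "ip (\<phi> n) p = 0"
proof -
  obtain c where "p = (\<Sum>k<n. smult (c k) (\<phi> k))"
    using phi_expansion assms by blast
  then show "ip p (\<phi> n) = 0" by (simp add: ip_sum_left ip_smult_left ip_phi)
  then show "ip (\<phi> n) p = 0" using ip_commute[of "\<phi> n" p] by simp
qed

lemma ip_definite:
  assumes "ip p p = 0"
  shows "p = 0"
proof -
  obtain c where c: "p = (\<Sum>k<Suc (degree p). smult (c k) (\<phi> k))"
    using phi_expansion[of "Suc (degree p)" p] by (auto simp: coeff_eq_0)
  have "ip p p = (\<Sum>k<Suc (degree p). c k * cnj (c k))"
    by (subst (1 2) c) (rule ip_phi_sums)
  also have "\<dots> = of_real (\<Sum>k<Suc (degree p). (cmod (c k))\<^sup>2)"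
    by (simp add: complex_norm_square del: of_real_power)
  finally have "(\<Sum>k<Suc (degree p). (cmod (c k))\<^sup>2) = 0"
    using assms by (metis of_real_eq_0_iff)
  then have "\<forall>k<Suc (degree p). c k = 0"
    by (subst (asm) sum_nonneg_eq_0_iff) auto
  then show ?thesis by (subst c) simp
qed

lemma phi_0: "\<phi> 0 = 1"
proof -
  have phi: "\<phi> 0 = [:of_real (kappa 0):]"
    using degree_phi[of 0] coeff_phi[of 0] by (metis degree_0_id)
  have "ip (\<phi> 0) (\<phi> 0) = of_real ((kappa 0)\<^sup>2)"
    unfolding phi ip_def by (simp add: prob_space power2_eq_square)
  then have "(kappa 0)\<^sup>2 = 1"
    unfolding ip_phi by (metis of_real_eq_1_iff)
  then show ?thesis
    using kappa_pos[of 0] by (simp add: phi power2_eq_1_iff one_pCons)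
qed

text \<open>On the circle \<open>\<phi>\<^sub>n\<^sup>* = z\<^sup>n cnj \<phi>\<^sub>n\<close>, so conjugation turns the orthogonality of \<open>\<phi>\<^sub>n\<close> to
  \<open>1, \<dots>, z\<^sup>n\<^sup>-\<^sup>1\<close> into orthogonality of \<open>\<phi>\<^sub>n\<^sup>*\<close> to \<open>z, \<dots>, z\<^sup>n\<close>.\<close>

lemma ip_star_phi:
  assumes "\<And>i. i \<ge> n \<Longrightarrow> coeff r i = 0"
  shows "ip (star (\<phi> n)) (pCons 0 r) = 0"
proof (cases "r = 0")
  case False
  then have deg: "degree r < n"
    using assms by (meson leading_coeff_neq_0 not_le)
  \<comment> \<open>the reversal of \<open>r\<close> as a polynomial of formal degree \<open>n - 1\<close>\<close>
  let ?r = "monom 1 (n - 1 - degree r) * star r"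
  have "degree (star r) \<le> degree r"
    by (intro degree_le) (simp add: coeff_star)
  then have "degree ?r < n"
    using degree_mult_le[of "monom (1::complex) (n - 1 - degree r)" "star r"] deg
    by (simp add: degree_monom_eq)
  have "ip (star (\<phi> n)) (pCons 0 r) = ip ?r (\<phi> n)"
  proof (rule ip_cong_circle)
    fix z :: complex assume z: "cmod z = 1"
    have "z ^ n * cnj z = z ^ (n - 1) * (z * cnj z)"
      using deg by (cases n) auto
    also have "\<dots> = z ^ (n - 1 - degree r) * z ^ degree r"
      using deg unit_mult_cnj[OF z] by (simp flip: power_add)
    finally show "poly (star (\<phi> n)) z * cnj (poly (pCons 0 r) z) = poly ?r z * cnj (poly (\<phi> n) z)"
      using z by (simp add: poly_star_circle degree_phi poly_monom mult_ac)
  qed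
  also have "\<dots> = 0"
    using \<open>degree ?r < n\<close> by (intro ip_low) (simp add: coeff_eq_0)
  finally show ?thesis .
qed simp

lemma ip_star_phi_self: "ip (star (\<phi> n)) (star (\<phi> n)) = 1"
proof -
  have "ip (star (\<phi> n)) (star (\<phi> n)) = ip (\<phi> n) (\<phi> n)"
  proof (rule ip_cong_circle)
    fix z :: complex assume z: "cmod z = 1"
    have "z ^ n * cnj z ^ n = 1"
      using z by (simp add: unit_mult_cnj flip: power_mult_distrib)
    then show "poly (star (\<phi> n)) z * cnj (poly (star (\<phi> n)) z) = poly (\<phi> n) z * cnj (poly (\<phi> n) z)"
      using z by (simp add: poly_star_circle degree_phi algebra_simps)
  qed
  then show ?thesis by (simp add: ip_phi)
qed

text \<open>The difference of both sides has degree at most \<open>n\<close> and vanishes at zero, hence lies in the span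
  of \<open>z, \<dots>, z\<^sup>n\<close>. All three polynomials are orthogonal to this span, so the difference is orthogonal to
  itself.\<close>

lemma monic_recursion:
  "smult (1 / of_real (kappa (Suc n))) (\<phi> (Suc n))
     = smult (1 / of_real (kappa n)) (pCons 0 (\<phi> n) + smult (schur_param \<phi> (Suc n)) (star (\<phi> n)))"
  (is "?L = ?R")
proof -
  let ?k = "complex_of_real (kappa n)" and ?k' = "complex_of_real (kappa (Suc n))"
  let ?a = "schur_param \<phi> (Suc n)"
  have k: "?k \<noteq> 0" "?k' \<noteq> 0"
    using kappa_pos[of n] kappa_pos[of "Suc n"] by auto
  define D where "D = ?L - ?R"
  have "coeff D 0 = 0"
    using k by (simp add: D_def coeff_star degree_phi coeff_phi schur_param_def)
  then obtain r where r: "D = pCons 0 r"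
    by (metis coeff_pCons_0 pCons_cases)
  have high: "coeff D i = 0" if i: "i \<ge> Suc n" for i
  proof (cases "i = Suc n")
    case True
    then show ?thesis
      using k by (simp add: D_def coeff_star degree_phi coeff_phi)
  next
    case False
    then obtain j where j: "i = Suc j" "j > n"
      using i False by (cases i) auto
    then show ?thesis
      by (simp add: D_def coeff_star degree_phi coeff_eq_0)
  qed
  have r_high: "coeff r i = 0" if "i \<ge> n" for i
    using high[of "Suc i"] that by (simp add: r)
  have "ip D D = 1 / ?k' * ip (\<phi> (Suc n)) D
          - 1 / ?k * (ip (pCons 0 (\<phi> n)) (pCons 0 r) + ?a * ip (star (\<phi> n)) (pCons 0 r))"
    by (subst D_def) (simp add: ip_diff_left ip_smult_left ip_add_left r)
  also have "\<dots> = 0"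
    using ip_low(2)[of "Suc n" D, OF high] ip_low(2)[of n r, OF r_high] ip_star_phi[of n r, OF r_high]
    by (simp add: ip_shift)
  finally have "D = 0" by (rule ip_definite)
  then show ?thesis by (simp add: D_def)
qed

text \<open>Pythagoras in the recursion, since \<open>\<phi>\<^sub>n\<^sub>+\<^sub>1\<close> is orthogonal to \<open>\<phi>\<^sub>n\<^sup>*\<close>. The left-hand side is
  positive, which is why the Schur parameters lie in the open unit disk.\<close>

lemma kappa_ratio: "(kappa n / kappa (Suc n))\<^sup>2 = 1 - (cmod (schur_param \<phi> (Suc n)))\<^sup>2"
proof -
  let ?k = "complex_of_real (kappa n)" and ?k' = "complex_of_real (kappa (Suc n))"
  let ?a = "schur_param \<phi> (Suc n)"
  have k: "?k \<noteq> 0" "?k' \<noteq> 0"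
    using kappa_pos[of n] kappa_pos[of "Suc n"] by auto
  have cross: "ip (star (\<phi> n)) (\<phi> (Suc n)) = 0" "ip (\<phi> (Suc n)) (star (\<phi> n)) = 0"
    using ip_low[of "Suc n" "star (\<phi> n)"] by (auto simp: coeff_star degree_phi)
  have "smult ?k (smult (1 / ?k') (\<phi> (Suc n)))
          = pCons 0 (\<phi> n) + smult ?a (star (\<phi> n))"
    unfolding monic_recursion using k by simp
  then have eq: "pCons 0 (\<phi> n) = smult (?k / ?k') (\<phi> (Suc n)) - smult ?a (star (\<phi> n))"
    by simp
  have "1 = ip (pCons 0 (\<phi> n)) (pCons 0 (\<phi> n))"
    by (simp add: ip_shift ip_phi)
  also have "\<dots> = (?k / ?k') * cnj (?k / ?k') + ?a * cnj ?a"
    unfolding eq by (simp add: ip_diff_left ip_diff_right ip_smult_left ip_smult_right cross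
        ip_phi ip_star_phi_self)
  also have "\<dots> = of_real ((kappa n / kappa (Suc n))\<^sup>2 + (cmod ?a)\<^sup>2)"
    unfolding of_real_add complex_norm_square by (simp add: power2_eq_square)
  finally have "(kappa n / kappa (Suc n))\<^sup>2 + (cmod ?a)\<^sup>2 = 1"
    by (metis of_real_eq_1_iff)
  then show ?thesis by simp
qed

sublocale schur_sequence "schur_param \<phi>"
proof
  fix n
  have "(kappa n / kappa (Suc n))\<^sup>2 > 0"
    using kappa_pos[of n] kappa_pos[of "Suc n"] by simp
  then have "(cmod (schur_param \<phi> (Suc n)))\<^sup>2 < 1"
    unfolding kappa_ratio by simp
  then show "cmod (schur_param \<phi> (Suc n)) < 1"
    by (simp add: power_less_one_iff)
qed

lemma phi_eq_szego: "\<phi> n = S n"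
proof (induction n)
  case 0
  then show ?case by (simp add: phi_0)
next
  case (Suc n)
  have pos: "kappa n > 0" "kappa (Suc n) > 0" by (rule kappa_pos)+
  then have "kappa n / kappa (Suc n) = rho n"
    unfolding rho_def kappa_ratio[symmetric] by simp
  then have "1 / rho n = kappa (Suc n) / kappa n"
    by (metis inverse_divide inverse_eq_divide)
  then have rho: "1 / complex_of_real (rho n) = of_real (kappa (Suc n)) / of_real (kappa n)"
    by (metis of_real_1 of_real_divide)
  have "\<phi> (Suc n) = smult (of_real (kappa (Suc n)))
          (smult (1 / of_real (kappa (Suc n))) (\<phi> (Suc n)))"
    using pos by simp
  also have "\<dots> = S (Suc n)"
    unfolding monic_recursion S_Suc rho Suc by simp
  finally show ?case .
qed

section \<open>The kernel off the support\<close>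

lemma ip_kernel: "ip (cd_kernel n v) (cd_kernel n w) = poly (cd_kernel n v) w"
  unfolding cd_kernel_def phi_eq_szego[symmetric] ip_phi_sums by (simp add: poly_sum)

lemma integrable_cmod_sq: "integrable \<mu> (\<lambda>z. (cmod (poly p z))\<^sup>2)"
  by (intro integrable_continuous continuous_intros)

text \<open>The polynomial \<open>(z - \<zeta>) K\<^sub>n(z, \<zeta>)\<close> has norm at most \<open>2 \<bar>S\<^sub>n(\<zeta>)\<bar>\<close> by the
  Christoffel-Darboux formula, because \<open>S\<^sub>n\<close> and \<open>S\<^sub>n\<^sup>*\<close> have norm one. If \<open>\<mu>\<close> keeps the distance \<open>\<epsilon>\<close>
  from \<open>\<zeta>\<close>, multiplication by \<open>z - \<zeta>\<close> shrinks the norm of the kernel at most by the factor \<open>\<epsilon>\<close>.\<close>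

lemma kernel_bound_off_support:
  assumes \<zeta>: "cmod \<zeta> = 1" and \<epsilon>: "\<epsilon> > 0"
    and gap: "AE z in \<mu>. cmod (z - \<zeta>) \<ge> \<epsilon>"
  shows "\<epsilon>\<^sup>2 * (\<Sum>k<n. (cmod (poly (S k) \<zeta>))\<^sup>2) \<le> 4 * (cmod (poly (S n) \<zeta>))\<^sup>2"
proof -
  let ?K = "cd_kernel n \<zeta>" and ?f = "\<lambda>z. poly (S n) z" and ?fs = "\<lambda>z. poly (star (S n)) z"
  have "complex_of_real (\<integral>z. (cmod (poly ?K z))\<^sup>2 \<partial>\<mu>) = of_real (\<Sum>k<n. (cmod (poly (S k) \<zeta>))\<^sup>2)"
    using ip_kernel[of n \<zeta> \<zeta>] unfolding ip_self kernel_diag .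
  then have K: "(\<integral>z. (cmod (poly ?K z))\<^sup>2 \<partial>\<mu>) = (\<Sum>k<n. (cmod (poly (S k) \<zeta>))\<^sup>2)"
    by (rule of_real_eq_iff[THEN iffD1])
  have "complex_of_real (\<integral>z. (cmod (?f z))\<^sup>2 \<partial>\<mu>) = 1"
    using ip_phi[of n n] unfolding ip_self phi_eq_szego[of n] by simp
  then have f: "(\<integral>z. (cmod (?f z))\<^sup>2 \<partial>\<mu>) = 1"
    by (rule of_real_eq_1_iff[THEN iffD1])
  have "(\<integral>z. \<epsilon>\<^sup>2 * (cmod (poly ?K z))\<^sup>2 \<partial>\<mu>) \<le> (\<integral>z. (4 * (cmod (?f \<zeta>))\<^sup>2) * (cmod (?f z))\<^sup>2 \<partial>\<mu>)"
  proof (rule integral_mono_AE)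
    show "AE z in \<mu>. \<epsilon>\<^sup>2 * (cmod (poly ?K z))\<^sup>2 \<le> (4 * (cmod (?f \<zeta>))\<^sup>2) * (cmod (?f z))\<^sup>2"
      using gap AE_circle
    proof eventually_elim
      case (elim z)
      have star: "cmod (?fs x) = cmod (?f x)" if "cmod x = 1" for x
        using that by (simp add: poly_star_S_circle norm_mult norm_power)
      have "\<epsilon> * cmod (poly ?K z) \<le> cmod (z - \<zeta>) * cmod (poly ?K z)"
        using elim by (intro mult_right_mono) auto
      also have "\<dots> = cmod (?fs z * ?f \<zeta> - ?f z * ?fs \<zeta>)"
        using kernel_circle[of z \<zeta> n] elim \<zeta> by simp
      also have "\<dots> \<le> cmod (?fs z * ?f \<zeta>) + cmod (?f z * ?fs \<zeta>)"
        by (rule norm_triangle_ineq4)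
      also have "\<dots> = 2 * cmod (?f \<zeta>) * cmod (?f z)"
        using elim \<zeta> by (simp add: norm_mult star)
      finally have "(\<epsilon> * cmod (poly ?K z))\<^sup>2 \<le> (2 * cmod (?f \<zeta>) * cmod (?f z))\<^sup>2"
        using \<epsilon> by (intro power_mono) auto
      then show ?case by (simp add: power_mult_distrib)
    qed
  qed (auto intro!: integrable_cmod_sq)
  then show ?thesis by (simp add: K f)
qed

end

locale opuc_para = opuc \<mu> \<phi> + para_orthogonal "schur_param \<phi>" w q
  for \<mu> \<phi> w q
begin

text \<open>In a gap of the support the kernel is dominated by \<open>S\<^sub>n\<close>, uniformly in \<open>n\<close>, while close zeros of
  consecutive polynomials need a large kernel. Only near \<open>w\<close> are the two compatible.\<close>

lemma roots_in_gap:
  assumes n: "n \<ge> 1" and \<zeta>: "poly (P n) \<zeta> = 0" and \<xi>: "poly (P (Suc n)) \<xi> = 0"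
    and \<epsilon>: "\<epsilon> > 0"
    and gap: "AE z in \<mu>. cmod (z - \<zeta>) \<ge> \<epsilon>" "AE z in \<mu>. cmod (z - \<xi>) \<ge> \<epsilon>"
  shows "\<epsilon>\<^sup>2 * cmod (\<xi> - w) \<le> 4 * cmod (\<zeta> - \<xi>)"
proof -
  have unit: "cmod \<zeta> = 1" "cmod \<xi> = 1"
    using root_circle[OF n \<zeta>] root_circle[OF _ \<xi>] by auto
  define K where "K x = (\<Sum>k<n. (cmod (poly (S k) x))\<^sup>2)" for x
  define f g where "f = cmod (poly (S n) \<zeta>)" and "g = cmod (poly (S n) \<xi>)"
  have bound: "\<epsilon>\<^sup>2 * K \<zeta> \<le> 4 * f\<^sup>2" "\<epsilon>\<^sup>2 * K \<xi> \<le> 4 * g\<^sup>2"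
    unfolding K_def f_def g_def by (intro kernel_bound_off_support unit \<epsilon> gap)+
  have K_pos: "K \<zeta> > 0" "K \<xi> > 0"
    unfolding K_def by (rule kernel_diag_pos[OF n])+
  have "0 < 4 * f\<^sup>2" "0 < 4 * g\<^sup>2"
    using \<epsilon> K_pos bound by (meson mult_pos_pos order_less_le_trans zero_less_power)+
  then have fg: "f * g > 0"
    unfolding f_def g_def by simp
  have "(\<epsilon>\<^sup>2 * cmod (poly (cd_kernel n \<xi>) \<zeta>))\<^sup>2 \<le> (\<epsilon>\<^sup>2)\<^sup>2 * (K \<zeta> * K \<xi>)"
    using kernel_cauchy_schwarz[of n \<xi> \<zeta>] unfolding K_def power_mult_distrib
    by (intro mult_left_mono) auto
  also have "\<dots> = (\<epsilon>\<^sup>2 * K \<zeta>) * (\<epsilon>\<^sup>2 * K \<xi>)"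
    by (simp add: power2_eq_square)
  also have "\<dots> \<le> (4 * f\<^sup>2) * (4 * g\<^sup>2)"
    using K_pos by (intro mult_mono[OF bound]) auto
  also have "\<dots> = (4 * (f * g))\<^sup>2"
    by (simp add: power_mult_distrib)
  finally have "\<epsilon>\<^sup>2 * cmod (poly (cd_kernel n \<xi>) \<zeta>) \<le> 4 * (f * g)"
    by (rule power2_le_imp_le) (use fg in simp)
  then have "cmod (\<zeta> - \<xi>) * (\<epsilon>\<^sup>2 * cmod (poly (cd_kernel n \<xi>) \<zeta>)) \<le> cmod (\<zeta> - \<xi>) * (4 * (f * g))"
    by (intro mult_left_mono) auto
  moreover have "(\<epsilon>\<^sup>2 * cmod (\<xi> - w)) * (f * g)
      = \<epsilon>\<^sup>2 * (cmod (\<zeta> - \<xi>) * cmod (poly (cd_kernel n \<xi>) \<zeta>))"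
    unfolding consecutive_roots[OF n \<zeta> \<xi>, symmetric] f_def g_def by simp
  ultimately have "(\<epsilon>\<^sup>2 * cmod (\<xi> - w)) * (f * g) \<le> (4 * cmod (\<zeta> - \<xi>)) * (f * g)"
    by (simp only: mult_ac)
  then show ?thesis
    using fg by (rule mult_right_le_imp_le)
qed

section \<open>Quadrature\<close>

text \<open>The kernels at the \<open>n\<close> distinct zeros are orthogonal by the reproducing property, so they form an
  orthogonal basis of the polynomials of degree less than \<open>n\<close>, in which the coefficients of a polynomial are,
  up to normalization, its values at the zeros. Parseval gives the formula.\<close>

lemma quadrature:
  assumes n: "n \<ge> 1" and low: "degree p < n"
  shows "(\<integral>z. (cmod (poly p z))\<^sup>2 \<partial>\<mu>)
           = (\<Sum>\<zeta> | poly (P n) \<zeta> = 0. (cmod (poly p \<zeta>))\<^sup>2 / (\<Sum>k<n. (cmod (poly (S k) \<zeta>))\<^sup>2))"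
proof -
  define Z where "Z = {\<zeta>. poly (P n) \<zeta> = 0}"
  have card: "card Z = n" unfolding Z_def by (rule card_roots[OF n])
  then have fin: "finite Z" using n by (metis card.infinite not_one_le_zero)
  define c where "c \<zeta> = poly p \<zeta> / poly (cd_kernel n \<zeta>) \<zeta>" for \<zeta>
  have orth: "poly (cd_kernel n \<zeta>) \<xi> = 0"
    if "\<zeta> \<in> Z" "\<xi> \<in> Z" "\<zeta> \<noteq> \<xi>" for \<zeta> \<xi>
    using that kernel_root_orthogonal[OF n] by (auto simp: Z_def)
  define r where "r = (\<Sum>\<zeta>\<in>Z. smult (c \<zeta>) (cd_kernel n \<zeta>))"
  have "poly p \<xi> = poly r \<xi>" if "\<xi> \<in> Z" for \<xi>
  proof -
    have "poly r \<xi> = (\<Sum>\<zeta>\<in>Z. if \<zeta> = \<xi> then c \<zeta> * poly (cd_kernel n \<zeta>) \<zeta> else 0)"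
      unfolding r_def poly_sum using that by (intro sum.cong) (auto simp: orth)
    then show ?thesis
      using that fin kernel_diag_nonzero[OF n, of \<xi>] by (simp add: c_def)
  qed
  moreover have "degree r < n"
  proof -
    have "degree (cd_kernel n \<zeta>) < n" for \<zeta>
      unfolding cd_kernel_def using n
      by (intro degree_sum_less) (auto simp: degree_S intro: le_less_trans[OF degree_smult_le])
    then show ?thesis
      unfolding r_def using n by (intro degree_sum_less le_less_trans[OF degree_smult_le]) auto
  qed
  ultimately have p: "p = r"
    using card low by (intro poly_eqI_degree[of Z]) auto
  have "ip p p = (\<Sum>\<zeta>\<in>Z. \<Sum>\<xi>\<in>Z. if \<zeta> = \<xi> then c \<zeta> * cnj (c \<xi>) * poly (cd_kernel n \<zeta>) \<zeta> else 0)"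
    unfolding p r_def ip_sum_left ip_sum_right
    by (intro sum.cong) (auto simp: ip_smult_left ip_smult_right ip_kernel orth)
  also have "\<dots> = (\<Sum>\<zeta>\<in>Z. c \<zeta> * cnj (c \<zeta>) * poly (cd_kernel n \<zeta>) \<zeta>)"
    using fin by simp
  also have "\<dots> = of_real (\<Sum>\<zeta>\<in>Z. (cmod (poly p \<zeta>))\<^sup>2 / (\<Sum>k<n. (cmod (poly (S k) \<zeta>))\<^sup>2))"
    unfolding of_real_sum
  proof (intro sum.cong refl)
    fix \<zeta> assume "\<zeta> \<in> Z"
    define k where "k = (\<Sum>k<n. (cmod (poly (S k) \<zeta>))\<^sup>2)"
    have "k \<noteq> 0" using kernel_diag_pos[OF n, of \<zeta>] by (simp add: k_def)
    then show "c \<zeta> * cnj (c \<zeta>) * poly (cd_kernel n \<zeta>) \<zeta>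
        = of_real ((cmod (poly p \<zeta>))\<^sup>2 / (\<Sum>k<n. (cmod (poly (S k) \<zeta>))\<^sup>2))"
      unfolding c_def kernel_diag k_def[symmetric] of_real_divide complex_norm_square
      by simp
  qed
  finally show ?thesis
    unfolding ip_self Z_def by (rule of_real_eq_iff[THEN iffD1])
qed

text \<open>The weights are positive and, by the formula for the constant polynomial, add up to one.\<close>

lemma quadrature_bound:
  assumes n: "n \<ge> 1" and low: "degree p < n"
    and B: "\<And>\<zeta>. poly (P n) \<zeta> = 0 \<Longrightarrow> (cmod (poly p \<zeta>))\<^sup>2 \<le> B"
  shows "(\<integral>z. (cmod (poly p z))\<^sup>2 \<partial>\<mu>) \<le> B"
proof -
  let ?W = "\<lambda>\<zeta>. (\<Sum>k<n. (cmod (poly (S k) \<zeta>))\<^sup>2)"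
  have "1 = (\<Sum>\<zeta> | poly (P n) \<zeta> = 0. 1 / ?W \<zeta>)"
    using quadrature[of n 1] n by (simp add: prob_space)
  then have "B = (\<Sum>\<zeta> | poly (P n) \<zeta> = 0. B / ?W \<zeta>)"
    by (metis (no_types, lifting) mult.right_neutral sum.cong sum_distrib_left times_divide_eq_right)
  moreover have "(\<Sum>\<zeta> | poly (P n) \<zeta> = 0. (cmod (poly p \<zeta>))\<^sup>2 / ?W \<zeta>)
      \<le> (\<Sum>\<zeta> | poly (P n) \<zeta> = 0. B / ?W \<zeta>)"
    using B by (intro sum_mono divide_right_mono) (auto intro: sum_nonneg)
  ultimately show ?thesis
    using quadrature[OF n low] by simp
qed

end

section \<open>Limit points of the roots\<close>

context opuc
begin

lemma supp_circle:
  assumes "\<tau> \<in> supp \<mu>" shows "cmod \<tau> = 1"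
proof (rule ccontr)
  assume "cmod \<tau> \<noteq> 1"
  moreover have "open (- sphere 0 1 :: complex set)"
    by (simp add: open_Compl)
  ultimately have "emeasure \<mu> (- sphere 0 1) > 0"
    using assms by (simp add: supp_def)
  moreover have "emeasure \<mu> {z \<in> space \<mu>. cmod z \<noteq> 1} = 0"
    by (rule emeasure_eq_0_AE) (use AE_circle in auto)
  moreover have "{z \<in> space \<mu>. cmod z \<noteq> 1} = - sphere 0 1"
    using sets_eq_imp_space_eq[OF sets_mu] by auto
  ultimately show False by simp
qed

lemma gap_of_non_support:
  assumes "\<tau> \<notin> supp \<mu>"
  obtains \<epsilon> where "\<epsilon> > 0" "\<And>\<zeta>. dist \<zeta> \<tau> < \<epsilon> \<Longrightarrow> AE z in \<mu>. cmod (z - \<zeta>) \<ge> \<epsilon>"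
proof -
  obtain U where U: "open U" "\<tau> \<in> U" "emeasure \<mu> U = 0"
    using assms by (auto simp: supp_def not_gr_zero)
  obtain e where e: "e > 0" "ball \<tau> e \<subseteq> U"
    using U open_contains_ball by blast
  have "U \<in> null_sets \<mu>"
    using U by (intro null_setsI) (auto simp: sets_mu)
  then have U_null: "AE z in \<mu>. z \<notin> U" by (rule AE_not_in)
  show ?thesis
  proof (rule that[of "e / 2"])
    fix \<zeta> assume \<zeta>: "dist \<zeta> \<tau> < e / 2"
    show "AE z in \<mu>. cmod (z - \<zeta>) \<ge> e / 2"
      using U_null
    proof eventually_elim
      case (elim z)
      then have "dist z \<tau> \<ge> e" using e by (auto simp: dist_commute not_less[symmetric])
      then show ?case
        using \<zeta> dist_triangle[of z \<tau> \<zeta>] unfolding dist_norm[symmetric] by linarith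
    qed
  qed (use e in simp)
qed

end

context opuc_para
begin

lemma zero_set_P: "n \<ge> 1 \<Longrightarrow> finite (zero_set (P n)) \<and> zero_set (P n) \<noteq> {}"
  using card_roots[of n] unfolding zero_set_def
  by (metis card.empty card.infinite not_one_le_zero)

lemma root_near_if_infdist_less:
  assumes "n \<ge> 1" "infdist \<tau> (zero_set (P n)) < \<eta>"
  obtains \<zeta> where "poly (P n) \<zeta> = 0" "dist \<zeta> \<tau> < \<eta>"
proof -
  have "closed (zero_set (P n))" "zero_set (P n) \<noteq> {}"
    using zero_set_P[OF assms(1)] by (auto intro: finite_imp_closed)
  then obtain \<zeta> where "\<zeta> \<in> zero_set (P n)" "infdist \<tau> (zero_set (P n)) = dist \<tau> \<zeta>"
    by (rule infdist_attains_inf)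
  then show ?thesis
    using assms(2) by (intro that[of \<zeta>]) (auto simp: zero_set_def dist_commute)
qed

lemma double_limit_point_in_supp:
  assumes "\<tau> \<in> double_limit_points (\<lambda>n. zero_set (P n))" "\<tau> \<noteq> w"
  shows "\<tau> \<in> supp \<mu>"
proof (rule ccontr)
  assume "\<tau> \<notin> supp \<mu>"
  then obtain \<epsilon> where \<epsilon>: "\<epsilon> > 0" and gap: "\<And>\<zeta>. dist \<zeta> \<tau> < \<epsilon> \<Longrightarrow> AE z in \<mu>. cmod (z - \<zeta>) \<ge> \<epsilon>"
    using gap_of_non_support by metis
  define d where "d = cmod (\<tau> - w)"
  have d: "d > 0" using assms(2) by (simp add: d_def)
  (* For two zeros within eta of tau the estimate in the gap
     would give eps^2 (d - eta) < 8 eta. *)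
  define \<eta> where "\<eta> = min \<epsilon> (\<epsilon>\<^sup>2 * d / (8 + \<epsilon>\<^sup>2))"
  have pos: "8 + \<epsilon>\<^sup>2 > 0" using zero_le_power2[of \<epsilon>] by linarith
  have "\<eta> \<le> \<epsilon>\<^sup>2 * d / (8 + \<epsilon>\<^sup>2)" by (simp add: \<eta>_def)
  then have "\<eta> * (8 + \<epsilon>\<^sup>2) \<le> \<epsilon>\<^sup>2 * d"
    by (simp only: pos_le_divide_eq[OF pos])
  moreover have "\<eta> > 0" "\<eta> \<le> \<epsilon>"
    using \<epsilon> d pos by (auto simp: \<eta>_def)
  ultimately have \<eta>: "\<eta> > 0" "\<eta> \<le> \<epsilon>" "\<eta> * (8 + \<epsilon>\<^sup>2) \<le> \<epsilon>\<^sup>2 * d" by auto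
  obtain I where I: "I \<subseteq> {1..}" "infinite I"
    and lim: "((\<lambda>n. infdist \<tau> (zero_set (P n))) \<longlongrightarrow> 0) (inf sequentially (principal I))"
      "((\<lambda>n. infdist \<tau> (zero_set (P (Suc n)))) \<longlongrightarrow> 0) (inf sequentially (principal I))"
    using assms(1) unfolding double_limit_points_def by blast
  have "eventually (\<lambda>n. infdist \<tau> (zero_set (P n)) < \<eta> \<and> infdist \<tau> (zero_set (P (Suc n))) < \<eta>)
          (inf sequentially (principal I))"
    using order_tendstoD(2)[OF lim(1) \<eta>(1)] order_tendstoD(2)[OF lim(2) \<eta>(1)]
    by (rule eventually_conj)
  then obtain N where N: "\<And>n. n \<ge> N \<Longrightarrow> n \<in> I \<Longrightarrow>
      infdist \<tau> (zero_set (P n)) < \<eta> \<and> infdist \<tau> (zero_set (P (Suc n))) < \<eta>"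
    unfolding eventually_inf_principal eventually_sequentially by blast
  obtain n where n: "n \<ge> N" "n \<in> I"
    using I(2) unfolding infinite_nat_iff_unbounded_le by blast
  then have n1: "n \<ge> 1" using I(1) by auto
  obtain \<zeta> where \<zeta>: "poly (P n) \<zeta> = 0" "dist \<zeta> \<tau> < \<eta>"
    using root_near_if_infdist_less[OF n1] N[OF n] by blast
  obtain \<xi> where \<xi>: "poly (P (Suc n)) \<xi> = 0" "dist \<xi> \<tau> < \<eta>"
    using root_near_if_infdist_less[of "Suc n"] N[OF n] by auto
  have "\<epsilon>\<^sup>2 * cmod (\<xi> - w) \<le> 4 * cmod (\<zeta> - \<xi>)"
    using \<zeta>(2) \<xi>(2) \<eta>(2) by (intro roots_in_gap[OF n1 \<zeta>(1) \<xi>(1) \<epsilon>] gap) auto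
  moreover have "cmod (\<zeta> - \<xi>) < 2 * \<eta>"
    using \<zeta>(2) \<xi>(2) dist_triangle2[of \<zeta> \<xi> \<tau>] by (simp add: dist_norm)
  moreover have "d - \<eta> < cmod (\<xi> - w)"
    using \<xi>(2) dist_triangle[of \<tau> w \<xi>] by (simp add: d_def dist_norm norm_minus_commute)
  then have "\<epsilon>\<^sup>2 * (d - \<eta>) < \<epsilon>\<^sup>2 * cmod (\<xi> - w)"
    using \<epsilon> by (intro mult_strict_left_mono) auto
  ultimately have "\<epsilon>\<^sup>2 * (d - \<eta>) < 8 * \<eta>" by linarith
  with \<eta>(3) show False by (simp add: algebra_simps)
qed

text \<open>The test polynomial \<open>((1 + cnj \<tau> z) / 2)\<^sup>m\<close> peaks at \<open>\<tau>\<close>: on the circle its squared modulus is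
  \<open>(1 - \<bar>z - \<tau>\<bar>\<^sup>2 / 4)\<^sup>m\<close>. For large \<open>m\<close> the mass of \<open>\<mu>\<close> close to \<open>\<tau>\<close> makes its squared norm
  larger than its values at distance \<open>\<epsilon>\<close> from \<open>\<tau>\<close>, so the quadrature formula needs a zero nearer to \<open>\<tau>\<close>.\<close>

lemma roots_near_supp:
  assumes \<tau>: "\<tau> \<in> supp \<mu>" and \<epsilon>: "\<epsilon> > 0"
  obtains m where "\<And>n. n > m \<Longrightarrow> \<exists>\<zeta>. poly (P n) \<zeta> = 0 \<and> dist \<zeta> \<tau> < \<epsilon>"
proof -
  define e where "e = min \<epsilon> 1"
  have e: "0 < e" "e \<le> 1" "e \<le> \<epsilon>" using \<epsilon> by (auto simp: e_def)
  have "e\<^sup>2 \<le> 1" "e\<^sup>2 > 0" using e by (auto simp: power_le_one)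
  \<comment> \<open>bounds for the base of the power outside \<open>ball \<tau> e\<close> and inside \<open>ball \<tau> (e / 2)\<close>\<close>
  define A B where "A = 1 - e\<^sup>2 / 4" and "B = 1 - e\<^sup>2 / 16"
  have AB: "0 \<le> A" "A < B" "0 < B"
    using \<open>e\<^sup>2 \<le> 1\<close> \<open>e\<^sup>2 > 0\<close> by (auto simp: A_def B_def)
  let ?D = "ball \<tau> (e / 2)"
  have D: "?D \<in> sets \<mu>" by (simp add: sets_mu)
  have "emeasure \<mu> ?D > 0"
    using \<tau> e unfolding supp_def by (metis (mono_tags, lifting) centre_in_ball half_gt_zero mem_Collect_eq open_ball)
  then have M: "measure \<mu> ?D > 0"
    by (simp add: emeasure_eq_measure)
  obtain m where "(A / B) ^ m < measure \<mu> ?D"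
    using real_arch_pow_inv[OF M, of "A / B"] AB by auto
  then have m: "A ^ m < B ^ m * measure \<mu> ?D"
    using AB by (simp add: power_divide field_simps)
  define p where "p = [:1/2, cnj \<tau> / 2:] ^ m"
  have p: "(cmod (poly p z))\<^sup>2 = (1 - (cmod (z - \<tau>))\<^sup>2 / 4) ^ m" if z: "cmod z = 1" for z
  proof -
    have 1: "z * cnj z = 1" "\<tau> * cnj \<tau> = 1"
      using z supp_circle[OF \<tau>] by (auto simp: unit_mult_cnj)
    have "\<tau> * (z * (cnj \<tau> * cnj z)) = (z * cnj z) * (\<tau> * cnj \<tau>)" by simp
    with 1 have "complex_of_real ((cmod ((1 + cnj \<tau> * z) / 2))\<^sup>2) = of_real (1 - (cmod (z - \<tau>))\<^sup>2 / 4)"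
      unfolding of_real_diff of_real_divide complex_norm_square by (simp add: field_simps)
    then have "(cmod ((1 + cnj \<tau> * z) / 2))\<^sup>2 = 1 - (cmod (z - \<tau>))\<^sup>2 / 4"
      by (rule of_real_eq_iff[THEN iffD1])
    moreover have "poly p z = ((1 + cnj \<tau> * z) / 2) ^ m"
      by (simp add: p_def poly_power field_simps)
    ultimately show ?thesis
      by (simp only: norm_power flip: power_mult) (simp only: mult.commute[of m] power_mult)
  qed
  have deg: "degree p \<le> m"
    unfolding p_def by (rule order_trans[OF degree_power_le]) simp
  have "B ^ m * measure \<mu> ?D = (\<integral>z. B ^ m * indicator ?D z \<partial>\<mu>)"
    using D by simp
  also have "\<dots> \<le> (\<integral>z. (cmod (poly p z))\<^sup>2 \<partial>\<mu>)"
  proof (rule integral_mono_AE)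
    show "integrable \<mu> (\<lambda>z. B ^ m * indicat_real ?D z)"
      using D by (intro integrable_mult_right integrable_real_indicator) (auto simp: less_top[symmetric])
    show "AE z in \<mu>. B ^ m * indicat_real ?D z \<le> (cmod (poly p z))\<^sup>2"
      using AE_circle
    proof eventually_elim
      case (elim z)
      show ?case
      proof (cases "z \<in> ?D")
        case True
        then have "cmod (z - \<tau>) \<le> e / 2" by (simp add: dist_norm norm_minus_commute)
        then have "(cmod (z - \<tau>))\<^sup>2 \<le> (e / 2)\<^sup>2" by (rule power_mono) simp
        then have "B \<le> 1 - (cmod (z - \<tau>))\<^sup>2 / 4" by (simp add: B_def power_divide)
        then show ?thesis
          using True AB by (simp add: p[OF elim] power_mono)
      qed simp
    qed
  qed (rule integrable_cmod_sq)
  finally have lower: "B ^ m * measure \<mu> ?D \<le> (\<integral>z. (cmod (poly p z))\<^sup>2 \<partial>\<mu>)" .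
  show ?thesis
  proof (rule that[of m], rule ccontr)
    fix n assume n: "n > m" and none: "\<not> (\<exists>\<zeta>. poly (P n) \<zeta> = 0 \<and> dist \<zeta> \<tau> < \<epsilon>)"
    have "(\<integral>z. (cmod (poly p z))\<^sup>2 \<partial>\<mu>) \<le> A ^ m"
    proof (rule quadrature_bound)
      fix \<zeta> assume \<zeta>: "poly (P n) \<zeta> = 0"
      then have unit: "cmod \<zeta> = 1" using root_circle[of n \<zeta>] n by auto
      have "e \<le> cmod (\<zeta> - \<tau>)" using none \<zeta> e by (auto simp: dist_norm)
      then have "e\<^sup>2 \<le> (cmod (\<zeta> - \<tau>))\<^sup>2" using e by (intro power_mono) auto
      then have "1 - (cmod (\<zeta> - \<tau>))\<^sup>2 / 4 \<le> A" by (simp add: A_def)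
      moreover have "cmod (\<zeta> - \<tau>) \<le> 2"
        using norm_triangle_ineq4[of \<zeta> \<tau>] unit supp_circle[OF \<tau>] by simp
      then have "(cmod (\<zeta> - \<tau>))\<^sup>2 \<le> 2\<^sup>2" by (rule power_mono) simp
      ultimately show "(cmod (poly p \<zeta>))\<^sup>2 \<le> A ^ m"
        unfolding p[OF unit] by (intro power_mono) auto
    qed (use n deg in auto)
    with lower m show False by linarith
  qed
qed

lemma supp_strong_limit_point:
  assumes "\<tau> \<in> supp \<mu>"
  shows "\<tau> \<in> strong_limit_points (\<lambda>n. zero_set (P n))"
proof -
  have "(\<lambda>n. infdist \<tau> (zero_set (P n))) \<longlonglongrightarrow> 0"
  proof (rule LIMSEQ_I)
    fix \<epsilon> :: real assume "\<epsilon> > 0"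
    then obtain m where m: "\<And>n. n > m \<Longrightarrow> \<exists>\<zeta>. poly (P n) \<zeta> = 0 \<and> dist \<zeta> \<tau> < \<epsilon>"
      using roots_near_supp assms by metis
    have "norm (infdist \<tau> (zero_set (P n)) - 0) < \<epsilon>" if "n \<ge> Suc m" for n
    proof -
      obtain \<zeta> where \<zeta>: "poly (P n) \<zeta> = 0" "dist \<zeta> \<tau> < \<epsilon>" using m[of n] \<open>n \<ge> Suc m\<close> by auto
      then have "infdist \<tau> (zero_set (P n)) \<le> dist \<tau> \<zeta>"
        by (intro infdist_le) (simp add: zero_set_def)
      with \<zeta> show ?thesis by (simp add: infdist_nonneg dist_commute)
    qed
    then show "\<exists>no. \<forall>n\<ge>no. norm (infdist \<tau> (zero_set (P n)) - 0) < \<epsilon>" by blast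
  qed
  then show ?thesis by (simp add: strong_limit_points_def)
qed

end

lemma strong_subset_double: "strong_limit_points E \<subseteq> double_limit_points E"
proof
  fix x assume "x \<in> strong_limit_points E"
  then have lim: "(\<lambda>n. infdist x (E n)) \<longlonglongrightarrow> 0"
    by (simp add: strong_limit_points_def)
  have "infinite {1::nat..}" by (rule infinite_Ici)
  moreover have "((\<lambda>n. infdist x (E n)) \<longlongrightarrow> 0) (inf sequentially (principal {1..}))"
    using lim by (rule tendsto_mono[rotated]) simp
  moreover have "((\<lambda>n. infdist x (E (Suc n))) \<longlongrightarrow> 0) (inf sequentially (principal {1..}))"
    using LIMSEQ_Suc[OF lim] by (rule tendsto_mono[rotated]) simp
  ultimately show "x \<in> double_limit_points E"
    unfolding double_limit_points_def by blast
qed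

text \<open>The second kind polynomials satisfy the recursion with the opposite sign in front of the
  reversed polynomial, and multiplication by \<open>\<i>\<close> restores the sign, as conjugation negates \<open>\<i>\<close>.\<close>

lemma (in opuc) para_orthogonal_comb:
  assumes w: "cmod w = 1" and c: "(c1, c2) \<noteq> (0, 0)"
  shows "opuc_para \<mu> \<phi> w (\<lambda>n. poly (comb_poly \<phi> c1 c2 n) w)"
    and "para_poly \<phi> c1 c2 w n = para_orthogonal.P (schur_param \<phi>) w (\<lambda>n. poly (comb_poly \<phi> c1 c2 n) w) n"
proof -
  interpret second: schur_sequence "\<lambda>n. - schur_param \<phi> n"
    by unfold_locales (simp add: schur_bound)
  have rho: "second.rho n = rho n" for n
    by (simp add: second.rho_def rho_def)
  have comb: "comb_poly \<phi> c1 c2 n = smult (of_real c1) (S n) + smult (\<i> * of_real c2) (second.S n)" for n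
    by (simp add: comb_poly_def second_kind_def phi_eq_szego[of n])
  let ?q = "\<lambda>n. poly (comb_poly \<phi> c1 c2 n) w"
  have lead: "complex_of_real c1 + \<i> * of_real c2 \<noteq> 0"
    using c by (auto simp: complex_eq_iff)
  have "para_orthogonal (schur_param \<phi>) w ?q"
  proof
    show "?q 0 \<noteq> 0" using lead by (simp add: comb)
    fix n
    let ?r = "complex_of_real (rho n)"
    have "?r * ?q (Suc n) = of_real c1 * (?r * poly (S (Suc n)) w)
            + \<i> * of_real c2 * (of_real (second.rho n) * poly (second.S (Suc n)) w)"
      unfolding rho by (simp add: comb algebra_simps del: szego_polys.simps)
    also have "\<dots> = w * ?q n + schur_param \<phi> (Suc n) * (w ^ n * cnj (?q n))"
      unfolding poly_S_Suc second.poly_S_Suc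
      by (simp add: comb poly_star_S_circle second.poly_star_S_circle w algebra_simps)
    finally show "?r * ?q (Suc n) = w * ?q n + schur_param \<phi> (Suc n) * (w ^ n * cnj (?q n))" .
  qed (rule w)
  then interpret para_orthogonal "schur_param \<phi>" w ?q .
  show "opuc_para \<mu> \<phi> w ?q" by unfold_locales
  have "coeff (comb_poly \<phi> c1 c2 n) n = (of_real c1 + \<i> * of_real c2) * coeff (S n) n"
    using degree_le_lead[of n] second.degree_le_lead[of n]
    by (simp add: comb rho algebra_simps)
  then have "coeff (comb_poly \<phi> c1 c2 n) n \<noteq> 0"
    using lead lead_nonzero by simp
  moreover have "degree (comb_poly \<phi> c1 c2 n) \<le> n"
    by (intro degree_le) (simp add: comb coeff_eq_0 degree_S second.degree_S)
  ultimately have "degree (comb_poly \<phi> c1 c2 n) = n"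
    by (simp add: le_antisym le_degree)
  then show "para_poly \<phi> c1 c2 w n = P n"
    by (simp add: para_poly_def P_def poly_star_circle w phi_eq_szego[of n])
qed

theorem corollary4p19:
  fixes \<mu> :: "complex measure"
    and \<phi> :: "nat \<Rightarrow> complex poly"
    and w :: complex
    and c1 c2 :: real
  assumes "circle_prob_measure \<mu>"
    and "infinite (supp \<mu>)"
    and "orthonormal_polys \<mu> \<phi>"
    and "w \<in> sphere 0 1"
    and "(c1, c2) \<noteq> (0, 0)"
  shows "let P = para_poly \<phi> c1 c2 w;
             E = (\<lambda>n. zero_set (P n))
         in double_limit_points E - {w} = supp \<mu> - {w} \<and>
            (w \<in> supp \<mu> \<longrightarrow> double_limit_points E = supp \<mu>) \<and>
            (c2 = 0 \<longrightarrow>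
               (\<forall>n\<ge>1. poly (P n) w = 0) \<and>
               double_limit_points E = supp \<mu> \<union> {w} \<and>
               strong_limit_points E = supp \<mu> \<union> {w})"
proof -
  interpret opuc \<mu> \<phi>
    using assms(1,3) by unfold_locales
  have w: "cmod w = 1" using assms(4) by simp
  let ?q = "\<lambda>n. poly (comb_poly \<phi> c1 c2 n) w"
  interpret opuc_para \<mu> \<phi> w ?q
    by (rule para_orthogonal_comb(1)[OF w assms(5)])
  have P: "para_poly \<phi> c1 c2 w = P"
    using para_orthogonal_comb(2)[OF w assms(5)] by (intro ext)
  define E where "E = (\<lambda>n. zero_set (P n))"
  have upper: "double_limit_points E \<subseteq> supp \<mu> \<union> {w}"
    using double_limit_point_in_supp unfolding E_def by blast
  have lower: "supp \<mu> \<subseteq> strong_limit_points E"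
    using supp_strong_limit_point unfolding E_def by blast
  have double: "strong_limit_points E \<subseteq> double_limit_points E"
    by (rule strong_subset_double)
  have root_w: "poly (P n) w = 0" if "c2 = 0" for n
  proof -
    have "?q n = of_real c1 * poly (S n) w"
      using that by (simp add: comb_poly_def phi_eq_szego[of n])
    then show ?thesis
      by (simp add: P_def poly_star_S_circle w)
  qed
  have "w \<in> strong_limit_points E" if "c2 = 0"
    using root_w[OF that] by (simp add: strong_limit_points_def E_def zero_set_def)
  with upper lower double root_w show ?thesis
    unfolding Let_def P E_def[symmetric] by blast
qed

end
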